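(* Let $p_1=2<p_2=3<p_3<\cdots$ denote the prime numbers in increasing order, let $P_n=\prod_{i=1}^n p_i$, and for real $s>1$ let $$D_n(s)=\sum_{k\ge 1,\ \gcd(k,P_n)=1}\frac{1}{k^s}=\zeta(s)\prod_{j=1}^n\left(1-\frac{1}{p_j^s}\right).$$ Let $s_n$ be the minimal positive real number such that for all $s\ge s_n$ one has $p_{n+1}=\lceil (D_n(s)-1)^{-1/s}\rceil$. Then for all $n\ge 1$, $s_n\le 2p_n$. Consequently, for all $n\ge1$, $$p_{n+1}=\left\lceil\left(-1+\zeta(2p_n)\prod_{j=1}^n\left(1-\frac{1}{p_j^{2p_n}}\right)\right)^{-1/(2p_n)}\right\rceil.$$
   Context: $p_j$ denotes the $j$-th prime; $P_n$ is the product of the first $n$ primes; $\zeta$ is the Riemann zeta function; $\lceil\cdot\rceil$ is the ceiling function.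
   Formalization: The minimal s_n does not exist, because the valid thresholds form an open ray; s_n is read as the infimum of the positive reals σ such that every s ≥ σ satisfies s > 1 and the ceiling formula, and this set is also shown to be non-empty. *)

theory Defs
  imports
    "HOL-Analysis.Analysis"
    "HOL-Computational_Algebra.Primes"
    "HOL-Library.Infinite_Set"
begin

(* Indexed from 1: nth_prime 1 = 2, nth_prime 2 = 3, ...; the value at 0 is never used. *)
definition nth_prime :: "nat \<Rightarrow> nat" where
  "nth_prime j = Infinite_Set.enumerate {p. prime p} (j - 1)"

definition primorial :: "nat \<Rightarrow> nat" where
  "primorial n = (\<Prod>i=1..n. nth_prime i)"

(* The Riemann zeta function on the real half-line s > 1, by its Dirichlet series. *)
definition zeta :: "real \<Rightarrow> real" where
  "zeta s = (\<Sum>\<^sub>\<infinity>k\<in>{1::nat..}. 1 / real k powr s)"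

definition D :: "nat \<Rightarrow> real \<Rightarrow> real" where
  "D n s = (\<Sum>\<^sub>\<infinity>k\<in>{k::nat. k \<ge> 1 \<and> gcd k (primorial n) = 1}. 1 / real k powr s)"

(* The conjunct 1 < s says that D n s is defined. *)
definition thresholds :: "nat \<Rightarrow> real set" where
  "thresholds n = {\<sigma>. 0 < \<sigma> \<and>
     (\<forall>s\<ge>\<sigma>. 1 < s \<and> int (nth_prime (n + 1)) = \<lceil>(D n s - 1) powr (- 1 / s)\<rceil>)}"

(* "Minimal" has to be read as the infimum.  For s > 1 the value (D n s - 1) powr (- 1 / s) is
   continuous in s, always below nth_prime (n + 1), and tends to 0 as s tends to 1 from above.
   Hence the ceiling equation is the open condition that this value exceeds nth_prime (n + 1) - 1,
   so the up-closed set thresholds n is an open ray and has no least element. *)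
definition s_min :: "nat \<Rightarrow> real" where
  "s_min n = Inf (thresholds n)"

end

theory Submission
  imports Defs "HOL-Library.Discrete_Functions"
begin

text \<open>
  Write \<open>p\<close> and \<open>q\<close> for the \<open>n\<close>-th and the next prime. The integers \<open>k > 1\<close> coprime to the
  primorial are odd and at least \<open>q\<close>, and \<open>q\<close> is one of them. Comparing the sum over odd \<open>k \<ge> q\<close>
  with an integral (midpoint rule) gives
  \<open>q powr (- s) \<le> D n s - 1 \<le> (q - 1) powr (1 - s) / (2 * (s - 1))\<close>, and the right-hand side is below
  \<open>(q - 1) powr (- s)\<close> as soon as \<open>q + 1 < 2 * s\<close>. For \<open>s \<ge> 2 * p\<close> this only requires
  \<open>q \<le> 4 * p - 2\<close>, a weak form of Bertrand's postulate. It follows by estimating the least common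
  multiple \<open>L\<close> of \<open>1, \<dots>, 2 * m + 1\<close> in two ways. Leibniz' harmonic triangle, in which each entry
  \<open>1 / ((n + 1) * (n choose k))\<close> is a difference of two neighbouring ones, shows that \<open>L\<close> is a multiple
  of \<open>(2 * m + 1) * (2 * m choose m)\<close>, so \<open>L \<ge> 4 ^ m\<close>. On the other hand only primes up to the square
  root of \<open>2 * m + 1\<close> divide \<open>L\<close> more than once, and the product of all primes up to \<open>x\<close> is at most
  \<open>4 ^ x\<close>; hence \<open>L\<close> is too small if there are no primes between \<open>x\<close> and \<open>2 * m + 1 = 4 * x - 3\<close>.
\<close>

section \<open>A weak form of Bertrand's postulate\<close>

definition leibniz_triangle :: "nat \<Rightarrow> nat \<Rightarrow> real" where
  "leibniz_triangle n k = 1 / real (Suc n * (n choose k))"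

lemma leibniz_triangle_Suc_Suc:
  assumes "k \<le> n"
  shows "leibniz_triangle (Suc n) (Suc k) = leibniz_triangle n k - leibniz_triangle (Suc n) k"
proof -
  define N c where "N = real (Suc n)" and "c = real (n choose k)"
  have "N > 0" "N > real k" "c > 0"
    using assms by (simp_all add: N_def c_def)
  have "real (Suc k) * real (Suc n choose Suc k) = N * c"
    unfolding N_def c_def by (simp only: Suc_times_binomial flip: of_nat_mult)
  then have lower_right: "real (Suc n choose Suc k) = N * c / (real k + 1)"
    by (simp add: field_simps)
  have "real (Suc n - k) * real (Suc n choose k) = N * c"
    unfolding N_def c_def of_nat_mult[symmetric] using binomial_absorb_comp[of "Suc n" k] by simp
  then have lower_left: "real (Suc n choose k) = N * c / (N - real k)"
    using assms \<open>N > real k\<close> by (simp add: N_def field_simps)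
  have "1 / ((N + 1) * (N * c / (real k + 1))) =
      1 / (N * c) - 1 / ((N + 1) * (N * c / (N - real k)))"
    using \<open>N > 0\<close> \<open>N > real k\<close> \<open>c > 0\<close> by (simp add: divide_simps)
  then show ?thesis
    unfolding leibniz_triangle_def of_nat_mult lower_left lower_right
    by (simp add: N_def c_def add_ac)
qed

lemma mult_leibniz_triangle_in_Ints:
  fixes L :: nat
  assumes "\<And>i. 1 \<le> i \<Longrightarrow> i \<le> Suc n \<Longrightarrow> i dvd L" and "k \<le> n"
  shows "real L * leibniz_triangle n k \<in> \<int>"
  using assms
proof (induction k arbitrary: n)
  case 0
  then have "Suc n dvd L"
    by simp
  then obtain l where "L = Suc n * l" ..
  then show ?case
    by (simp add: leibniz_triangle_def del: of_nat_Suc mult_Suc)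
next
  case (Suc k)
  then obtain m where n: "n = Suc m" and "k \<le> m"
    by (cases n) auto
  have "real L * leibniz_triangle m k - real L * leibniz_triangle n k \<in> \<int>"
    using Suc.prems n \<open>k \<le> m\<close> by (intro Ints_diff Suc.IH) auto
  then show ?case
    by (simp add: n leibniz_triangle_Suc_Suc[OF \<open>k \<le> m\<close>] right_diff_distrib)
qed

definition Lcm_atMost :: "nat \<Rightarrow> nat" where
  "Lcm_atMost n = Lcm {1..n}"

lemma Lcm_atMost_pos: "Lcm_atMost n > 0"
  by (rule Nat.gr0I) (simp add: Lcm_atMost_def Lcm_0_iff)

lemma dvd_Lcm_atMost: "1 \<le> k \<Longrightarrow> k \<le> n \<Longrightarrow> k dvd Lcm_atMost n"
  by (auto simp: Lcm_atMost_def intro: dvd_Lcm)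

lemma Suc_times_binomial_dvd_Lcm_atMost:
  assumes "k \<le> n"
  shows "Suc n * (n choose k) dvd Lcm_atMost (Suc n)"
proof -
  define d where "d = Suc n * (n choose k)"
  have "d > 0"
    using assms by (simp add: d_def)
  have "real (Lcm_atMost (Suc n)) * leibniz_triangle n k \<in> \<int>"
    using assms by (intro mult_leibniz_triangle_in_Ints dvd_Lcm_atMost)
  then obtain z where "real (Lcm_atMost (Suc n)) / real d = of_int z"
    unfolding leibniz_triangle_def d_def[symmetric] by (auto elim: Ints_cases)
  then have "real_of_int (int (Lcm_atMost (Suc n))) = real_of_int (int d * z)"
    using \<open>d > 0\<close> by (simp add: field_simps)
  then have "int (Lcm_atMost (Suc n)) = int d * z"
    by (simp only: of_int_eq_iff)
  then show ?thesis
    unfolding d_def[symmetric] by (metis dvd_triv_left int_dvd_int_iff)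
qed

lemma four_power_le_Lcm_atMost: "4 ^ m \<le> Lcm_atMost (Suc (2 * m))"
proof -
  have "(4::nat) ^ m = (\<Sum>k\<le>2 * m. 2 * m choose k)"
    by (simp add: choose_row_sum power_mult)
  also have "\<dots> \<le> Suc (2 * m) * (2 * m choose m)"
    using sum_bounded_above[of "{..2 * m}" "\<lambda>k. 2 * m choose k"] by (simp add: binomial_maximum')
  also have "\<dots> \<le> Lcm_atMost (Suc (2 * m))"
    by (rule dvd_imp_le[OF Suc_times_binomial_dvd_Lcm_atMost Lcm_atMost_pos]) simp
  finally show ?thesis .
qed

lemma multiplicity_Lcm:
  fixes A :: "'a :: {factorial_semiring_gcd, semiring_Gcd} set"
  assumes "finite A" "A \<noteq> {}" "0 \<notin> A" "prime p"
  shows "multiplicity p (Lcm A) = Max (multiplicity p ` A)"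
  using assms(1-3)
proof (induction A rule: finite_ne_induct)
  case (insert a A)
  then show ?case
    using \<open>prime p\<close> by (simp add: multiplicity_lcm Lcm_0_iff)
qed simp

lemma prime_power_multiplicity_Lcm_atMost_le:
  fixes p :: nat
  assumes "prime p" "n > 0"
  shows "p ^ multiplicity p (Lcm_atMost n) \<le> n"
proof -
  have "multiplicity p (Lcm_atMost n) \<in> multiplicity p ` {1..n}"
    unfolding Lcm_atMost_def using assms by (subst multiplicity_Lcm) (auto intro!: Max_in)
  then obtain a where "a \<in> {1..n}" "multiplicity p (Lcm_atMost n) = multiplicity p a"
    by auto
  then have "p ^ multiplicity p (Lcm_atMost n) \<le> a"
    by (intro dvd_imp_le) (auto simp: multiplicity_dvd)
  with \<open>a \<in> {1..n}\<close> show ?thesis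
    by simp
qed

definition primes_atMost :: "nat \<Rightarrow> nat set" where
  "primes_atMost n = {p. prime p \<and> p \<le> n}"

lemma finite_primes_atMost [simp, intro]: "finite (primes_atMost n)"
  by (rule finite_subset[of _ "{..n}"]) (auto simp: primes_atMost_def)

lemma primes_atMost_0: "primes_atMost 0 = {}"
  by (auto simp: primes_atMost_def)

lemma primes_atMost_Suc:
  "primes_atMost (Suc n) =
    (if prime (Suc n) then insert (Suc n) (primes_atMost n) else primes_atMost n)"
  by (auto simp: primes_atMost_def le_Suc_eq)

lemma prime_factors_Lcm_atMost: "prime_factors (Lcm_atMost n) = primes_atMost n"
proof (intro equalityI subsetI)
  fix p assume "p \<in> prime_factors (Lcm_atMost n)"
  then have "prime p" "multiplicity p (Lcm_atMost n) > 0" and "n > 0"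
    by (auto simp: prime_factors_multiplicity Lcm_atMost_def intro!: Nat.gr0I)
  then have "p \<le> p ^ multiplicity p (Lcm_atMost n)"
    by (intro self_le_power) (auto intro: Suc_leI prime_gt_0_nat)
  also have "\<dots> \<le> n"
    by (rule prime_power_multiplicity_Lcm_atMost_le) fact+
  finally show "p \<in> primes_atMost n"
    using \<open>prime p\<close> by (simp add: primes_atMost_def)
next
  fix p assume "p \<in> primes_atMost n"
  then show "p \<in> prime_factors (Lcm_atMost n)"
    using Lcm_atMost_pos[of n]
    by (auto simp: primes_atMost_def in_prime_factors_iff intro: dvd_Lcm_atMost prime_ge_1_nat)
qed

lemma prime_power_multiplicity_Lcm_atMost_le_prime:
  assumes "prime p" "n > 0" "floor_sqrt n < p"
  shows "p ^ multiplicity p (Lcm_atMost n) \<le> p"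
proof -
  have "p ^ multiplicity p (Lcm_atMost n) \<le> n"
    using assms by (intro prime_power_multiplicity_Lcm_atMost_le)
  also have "n < p\<^sup>2"
    using assms by (metis le_floor_sqrt_iff not_le)
  finally have "multiplicity p (Lcm_atMost n) < 2"
    by (rule power_less_imp_less_exp[OF prime_gt_1_nat[OF \<open>prime p\<close>]])
  then show ?thesis
    using power_increasing[of "multiplicity p (Lcm_atMost n)" 1 p] prime_ge_1_nat[OF \<open>prime p\<close>]
    by simp
qed

lemma Lcm_atMost_le:
  assumes "n > 0"
  shows "Lcm_atMost n \<le> n ^ floor_sqrt n * \<Prod>(primes_atMost n)"
proof -
  define k where "k = floor_sqrt n"
  define e where "e p = multiplicity p (Lcm_atMost n)" for p
  have prime_power_le: "p ^ e p \<le> (if p \<le> k then n else 1) * p" if "prime p" for p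
  proof (cases "p \<le> k")
    case True
    have "p ^ e p \<le> n * 1"
      unfolding e_def using prime_power_multiplicity_Lcm_atMost_le[OF that assms] by simp
    also have "\<dots> \<le> n * p"
      using prime_ge_1_nat[OF that] by (intro mult_le_mono2)
    finally show ?thesis
      using True by simp
  next
    case False
    then show ?thesis
      using prime_power_multiplicity_Lcm_atMost_le_prime[OF that assms] by (simp add: e_def k_def)
  qed
  have "Lcm_atMost n = (\<Prod>p\<in>primes_atMost n. p ^ e p)"
    using prime_factorization_nat[OF Lcm_atMost_pos[of n]]
    by (simp add: prime_factors_Lcm_atMost e_def)
  also have "\<dots> \<le> (\<Prod>p\<in>primes_atMost n. (if p \<le> k then n else 1) * p)"
    using prime_power_le by (intro prod_mono) (auto simp: primes_atMost_def)
  also have "\<dots> = n ^ card (primes_atMost n \<inter> {..k}) * \<Prod>(primes_atMost n)"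
    by (simp add: prod.distrib prod.If_cases atMost_def)
  also have "\<dots> \<le> n ^ k * \<Prod>(primes_atMost n)"
  proof (intro mult_le_mono1 power_increasing)
    have "card (primes_atMost n \<inter> {..k}) \<le> card {1..k}"
      by (intro card_mono) (auto simp: primes_atMost_def Suc_le_eq prime_gt_0_nat)
    then show "card (primes_atMost n \<inter> {..k}) \<le> k"
      by simp
  qed (use assms in simp)
  finally show ?thesis
    by (simp add: k_def)
qed

lemma prime_dvd_binomial:
  fixes p :: nat
  assumes "prime p" "k < p" "n - k < p" "k \<le> n" "p \<le> n"
  shows "p dvd n choose k"
proof -
  have "p dvd fact k * fact (n - k) * (n choose k)"
    using assms by (simp add: binomial_fact_lemma prime_dvd_fact_iff)
  then show ?thesis
    using assms by (simp add: prime_dvd_mult_iff prime_dvd_fact_iff)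
qed

lemma odd_binomial_le_four_power: "Suc (2 * m) choose m \<le> 4 ^ m"
proof -
  have "Suc (2 * m) choose m \<le> (\<Sum>k\<le>m. Suc (2 * m) choose k)"
    by (intro member_le_sum) auto
  also have "\<dots> = 4 ^ m"
    using binomial_r_part_sum[of m] by (simp add: power_mult)
  finally show ?thesis .
qed

lemma prod_pairwise_coprime_dvd:
  fixes f :: "'b \<Rightarrow> 'a :: semiring_gcd"
  assumes "finite A" "pairwise (\<lambda>i j. coprime (f i) (f j)) A" "\<And>i. i \<in> A \<Longrightarrow> f i dvd c"
  shows "prod f A dvd c"
  using assms
proof (induction A rule: finite_induct)
  case (insert i A)
  have "coprime (f i) (prod f A)"
    using insert by (intro prod_coprime_right) (auto simp: pairwise_insert)
  then show ?case
    using insert by (simp add: divides_mult pairwise_insert)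
qed simp

lemma prod_primes_odd_interval_le:
  "\<Prod>(primes_atMost (Suc (2 * m)) - primes_atMost (Suc m)) \<le> 4 ^ m" (is "\<Prod>?P \<le> _")
proof -
  have "\<Prod>?P dvd Suc (2 * m) choose m"
  proof (rule prod_pairwise_coprime_dvd)
    show "pairwise coprime ?P"
      by (auto simp: pairwise_def primes_atMost_def intro: primes_coprime)
    show "p dvd Suc (2 * m) choose m" if "p \<in> ?P" for p
      using that by (intro prime_dvd_binomial) (auto simp: primes_atMost_def)
  qed auto
  then have "\<Prod>?P \<le> Suc (2 * m) choose m"
    by (rule dvd_imp_le) simp
  also have "\<dots> \<le> 4 ^ m"
    by (rule odd_binomial_le_four_power)
  finally show ?thesis .
qed

lemma prod_primes_atMost_le: "\<Prod>(primes_atMost n) \<le> 4 ^ n"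
proof (induction n rule: less_induct)
  case (less n)
  consider "n \<le> 2" | "n > 2" "even n" | m where "n = Suc (2 * m)" "m > 0"
    by (cases "n \<le> 2"; cases "even n") (auto elim!: oddE)
  then show ?case
  proof cases
    case 1
    then consider "n = 0" | "n = Suc 0" | "n = Suc (Suc 0)"
      by linarith
    then show ?thesis
      by cases (simp_all add: primes_atMost_0 primes_atMost_Suc)
  next
    case 2
    then obtain m where n: "n = Suc m"
      by (cases n) auto
    have "\<not> prime n"
      using 2 prime_odd_nat by blast
    then have "\<Prod>(primes_atMost n) = \<Prod>(primes_atMost m)"
      by (simp add: n primes_atMost_Suc)
    also have "\<dots> \<le> 4 ^ m"
      by (intro less) (simp add: n)
    also have "\<dots> \<le> 4 ^ n"
      by (simp add: n)
    finally show ?thesis .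
  next
    case (3 m)
    have "\<Prod>(primes_atMost n) =
        \<Prod>(primes_atMost n - primes_atMost (Suc m)) * \<Prod>(primes_atMost (Suc m))"
      using 3 by (intro prod.subset_diff) (auto simp: primes_atMost_def)
    also have "\<dots> \<le> 4 ^ m * 4 ^ Suc m"
      using 3 by (intro mult_le_mono less) (auto intro: prod_primes_odd_interval_le)
    also have "\<dots> = 4 ^ (m + Suc m)"
      by (rule power_add [symmetric])
    also have "m + Suc m = n"
      using 3 by simp
    finally show ?thesis .
  qed
qed

lemma power4_le_two_power:
  fixes n :: nat
  assumes "n \<ge> 19"
  shows "n ^ 4 \<le> 2 ^ (n - 2)"
  using assms
proof (induction n rule: nat_induct_at_least)
  case (Suc n)
  have "real (Suc n) ^ 4 \<le> (20 / 19 * real n) ^ 4"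
    using Suc by (intro power_mono) auto
  also have "\<dots> \<le> 2 * real n ^ 4"
    by (simp add: power_mult_distrib power_divide)
  finally have "real (Suc n ^ 4) \<le> real (2 * n ^ 4)"
    by simp
  then have "Suc n ^ 4 \<le> 2 * n ^ 4"
    by (simp only: of_nat_le_iff)
  also have "\<dots> \<le> 2 * 2 ^ (n - 2)"
    using Suc by simp
  also have "\<dots> = 2 ^ (Suc n - 2)"
    using Suc by (simp flip: power_Suc add: Suc_diff_le)
  finally show ?case .
qed simp

lemma power_floor_sqrt_squared_le:
  assumes "n \<ge> 324"
  shows "(n ^ floor_sqrt n)\<^sup>2 \<le> 2 ^ (n - 18)"
proof -
  define k where "k = floor_sqrt n"
  have "18 \<le> k"
    using assms by (simp add: k_def le_floor_sqrt_iff)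
  have "n \<le> (Suc k)\<^sup>2"
    unfolding k_def by (intro less_imp_le Suc_floor_sqrt_power2_gt)
  then have "(n ^ k)\<^sup>2 \<le> (((Suc k)\<^sup>2) ^ k)\<^sup>2"
    by (intro power_mono) auto
  also have "\<dots> = (Suc k ^ 4) ^ k"
    by (simp flip: power_mult add: mult_ac)
  also have "\<dots> \<le> (2 ^ (Suc k - 2)) ^ k"
    using \<open>18 \<le> k\<close> by (intro power_mono power4_le_two_power) auto
  also have "\<dots> = 2 ^ (k\<^sup>2 - k)"
    by (simp flip: power_mult add: diff_mult_distrib power2_eq_square)
  also have "k\<^sup>2 - k \<le> n - 18"
    using \<open>18 \<le> k\<close> floor_sqrt_power2_le[of n] unfolding k_def[symmetric] by linarith
  then have "(2::nat) ^ (k\<^sup>2 - k) \<le> 2 ^ (n - 18)"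
    by (rule power_increasing) simp
  finally show ?thesis
    by (simp add: k_def)
qed

lemma ex_prime_between_four_times_of_ge_82:
  fixes x :: nat
  assumes "x \<ge> 82"
  shows "\<exists>q. prime q \<and> x < q \<and> q \<le> 4 * x - 3"
proof (rule ccontr)
  assume no_prime: "\<not> ?thesis"
  define n where "n = 4 * x - 3"
  have n: "n = Suc (2 * (2 * x - 2))" "n \<ge> 324"
    using assms by (auto simp: n_def)
  have "p \<le> x" if "prime p" "p \<le> n" for p
    using no_prime that unfolding n_def by (meson not_le)
  then have "primes_atMost n = primes_atMost x"
    using assms by (auto simp: primes_atMost_def n_def)
  then have "\<Prod>(primes_atMost n) \<le> 4 ^ x"
    using prod_primes_atMost_le[of x] by simp
  have "(4::nat) ^ (x - 2) * 4 ^ x = 4 ^ (2 * x - 2)"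
    unfolding power_add [symmetric] using assms by simp
  also have "\<dots> \<le> Lcm_atMost n"
    unfolding n(1) by (rule four_power_le_Lcm_atMost)
  also have "\<dots> \<le> n ^ floor_sqrt n * \<Prod>(primes_atMost n)"
    using n by (intro Lcm_atMost_le) simp
  also have "\<dots> \<le> n ^ floor_sqrt n * 4 ^ x"
    by (rule mult_le_mono2) fact
  finally have "4 ^ (x - 2) \<le> n ^ floor_sqrt n"
    by simp
  then have "(4 ^ (x - 2))\<^sup>2 \<le> (n ^ floor_sqrt n)\<^sup>2"
    by (rule power_mono) simp
  also have "\<dots> \<le> 2 ^ (n - 18)"
    using n by (intro power_floor_sqrt_squared_le)
  also have "((4::nat) ^ (x - 2))\<^sup>2 = (2\<^sup>2) ^ ((x - 2) * 2)"
    by (simp flip: power_mult)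
  also have "\<dots> = 2 ^ (4 * (x - 2))"
    by (simp only: power_mult [symmetric]) (simp add: mult_ac)
  finally have "4 * (x - 2) \<le> n - 18"
    by simp
  then show False
    using assms by (simp add: n_def)
qed

lemma ex_prime_between_four_times:
  fixes x :: nat
  assumes "x \<ge> 2"
  shows "\<exists>q. prime q \<and> x < q \<and> q \<le> 4 * x - 3"
proof -
  have primes: "prime (5::nat)" "prime (17::nat)" "prime (61::nat)" "prime (83::nat)"
    by simp_all
  consider "x < 5" | "5 \<le> x" "x < 17" | "17 \<le> x" "x < 61" | "61 \<le> x" "x < 82" | "x \<ge> 82"
    by linarith
  then show ?thesis
  proof cases
    case 1
    then show ?thesis
      using primes assms by (intro exI[of _ 5]) auto
  next
    case 2
    then show ?thesis
      using primes by (intro exI[of _ 17]) auto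
  next
    case 3
    then show ?thesis
      using primes by (intro exI[of _ 61]) auto
  next
    case 4
    then show ?thesis
      using primes by (intro exI[of _ 83]) auto
  next
    case 5
    then show ?thesis
      by (rule ex_prime_between_four_times_of_ge_82)
  qed
qed

section \<open>Dirichlet series over sets of integers\<close>

lemma convex_on_midpoint_rule:
  fixes f F :: "real \<Rightarrow> real"
  assumes convex: "convex_on {c - h..c + h} f" and "h \<ge> 0"
    and antiderivative: "\<And>x. x \<in> {c - h..c + h} \<Longrightarrow> (F has_real_derivative f x) (at x)"
  shows "2 * h * f c \<le> F (c + h) - F (c - h)"
proof -
  define G where "G t = F (c + t) - F (c - t) - 2 * t * f c" for t
  have "G 0 \<le> G h"
  proof (rule DERIV_nonneg_imp_nondecreasing[OF \<open>h \<ge> 0\<close>])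
    fix t assume t: "0 \<le> t" "t \<le> h"
    have "(G has_real_derivative f (c + t) + f (c - t) - 2 * f c) (at t)"
      unfolding G_def using t
      by (auto intro!: derivative_eq_intros DERIV_chain2[OF antiderivative])
    moreover have "f ((1 - 1 / 2) *\<^sub>R (c - t) + (1 / 2) *\<^sub>R (c + t))
        \<le> (1 - 1 / 2) * f (c - t) + 1 / 2 * f (c + t)"
      using t by (intro convex_onD[OF convex]) auto
    then have "0 \<le> f (c + t) + f (c - t) - 2 * f c"
      by (simp add: field_simps)
    ultimately show "\<exists>y. (G has_real_derivative y) (at t) \<and> 0 \<le> y"
      by blast
  qed
  then show ?thesis
    by (simp add: G_def)
qed

lemma convex_on_powr_minus:
  assumes "s \<ge> 0"
  shows "convex_on {0<..} (\<lambda>x::real. x powr (- s))"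
proof (rule f''_ge0_imp_convex)
  fix x :: real assume "x \<in> {0<..}"
  then show "((\<lambda>x. x powr (- s)) has_real_derivative - s * x powr (- s - 1)) (at x)"
    and "((\<lambda>x. - s * x powr (- s - 1)) has_real_derivative
      s * (s + 1) * x powr (- s - 2)) (at x)"
    by (auto intro!: derivative_eq_intros simp: algebra_simps)
qed (use assms in auto)

lemma powr_minus_midpoint_le:
  fixes c h s :: real
  assumes "s > 1" "0 \<le> h" "h < c"
  shows "2 * h * (s - 1) * c powr (- s) \<le> (c - h) powr (1 - s) - (c + h) powr (1 - s)"
proof -
  have "2 * h * c powr (- s) \<le> (c + h) powr (1 - s) / (1 - s) - (c - h) powr (1 - s) / (1 - s)"
  proof (rule convex_on_midpoint_rule)
    show "convex_on {c - h..c + h} (\<lambda>x. x powr (- s))"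
      using assms by (intro convex_on_subset[OF convex_on_powr_minus]) auto
    fix x assume "x \<in> {c - h..c + h}"
    then show "((\<lambda>x. x powr (1 - s) / (1 - s)) has_real_derivative x powr (- s)) (at x)"
      using assms DERIV_cdivide[OF has_real_derivative_powr[of x "1 - s"], of "1 - s"] by simp
  qed fact
  then have "2 * h * c powr (- s) \<le> ((c + h) powr (1 - s) - (c - h) powr (1 - s)) / (1 - s)"
    by (simp only: diff_divide_distrib)
  then show ?thesis
    using assms by (simp add: neg_le_divide_eq algebra_simps)
qed

lemma sum_powr_minus_arith_progression_le:
  fixes a d s :: real
  assumes "s > 1" "d > 0" "2 * a > d"
  shows "(\<Sum>i<n. (a + d * real i) powr (- s)) \<le> (a - d / 2) powr (1 - s) / (d * (s - 1))"
proof -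
  define g where "g i = (a - d / 2 + d * real i) powr (1 - s)" for i
  have "d * (s - 1) * (\<Sum>i<n. (a + d * real i) powr (- s)) \<le> (\<Sum>i<n. g i - g (Suc i))"
    unfolding sum_distrib_left
  proof (rule sum_mono)
    fix i
    have "d / 2 < a + d * real i"
      using assms mult_nonneg_nonneg[of d "real i"] by linarith
    then show "d * (s - 1) * (a + d * real i) powr (- s) \<le> g i - g (Suc i)"
      using powr_minus_midpoint_le[of s "d / 2" "a + d * real i"] assms
      by (simp add: g_def algebra_simps)
  qed
  also have "\<dots> = g 0 - g n"
    by (rule sum_lessThan_telescope')
  also have "\<dots> \<le> (a - d / 2) powr (1 - s)"
    by (simp add: g_def)
  finally show ?thesis
    using assms by (simp add: field_simps)
qed

lemma summable_on_inverse_powr: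
  fixes s :: real and A :: "nat set"
  assumes "s > 1"
  shows "(\<lambda>k. 1 / real k powr s) summable_on A"
proof -
  have "summable (\<lambda>k. real k powr (- s))"
    using assms by (simp add: summable_real_powr_iff)
  then have "(\<lambda>k. 1 / real k powr s) summable_on UNIV"
    by (simp add: summable_on_UNIV_nonneg_real_iff powr_minus_divide)
  then show ?thesis
    by (rule summable_on_subset) simp
qed

lemma infsum_inverse_powr_arith_progression_le:
  fixes q d :: nat and s :: real
  assumes "s > 1" "d > 0" "2 * q > d" and progression: "A \<subseteq> range (\<lambda>i. q + d * i)"
  shows "(\<Sum>\<^sub>\<infinity>k\<in>A. 1 / real k powr s) \<le>
    (real q - real d / 2) powr (1 - s) / (real d * (s - 1))"
proof (rule infsum_le_finite_sums[OF summable_on_inverse_powr[OF \<open>s > 1\<close>]])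
  fix K assume "finite K" "K \<subseteq> A"
  then obtain I where I: "finite I" "K = (\<lambda>i. q + d * i) ` I"
    using progression by (meson finite_subset_image order_trans)
  then obtain n where "I \<subseteq> {..<n}"
    using finite_nat_bounded by blast
  have "(\<Sum>k\<in>K. 1 / real k powr s) = (\<Sum>i\<in>I. (real q + real d * real i) powr (- s))"
    unfolding I(2) using \<open>d > 0\<close>
    by (subst sum.reindex) (auto intro!: inj_onI simp: powr_minus_divide)
  also have "\<dots> \<le> (\<Sum>i<n. (real q + real d * real i) powr (- s))"
    using \<open>I \<subseteq> {..<n}\<close> by (intro sum_mono2) auto
  also have "\<dots> \<le> (real q - real d / 2) powr (1 - s) / (real d * (s - 1))"
    using assms by (intro sum_powr_minus_arith_progression_le) (auto simp flip: of_nat_less_iff)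
  finally show "(\<Sum>k\<in>K. 1 / real k powr s) \<le>
      (real q - real d / 2) powr (1 - s) / (real d * (s - 1))" .
qed

lemma infsum_inverse_powr_not_dvd:
  fixes s :: real and p :: nat
  assumes "s > 1" "p > 0" and mult_mem_iff: "\<And>k. p * k \<in> A \<longleftrightarrow> k \<in> A"
  shows "(\<Sum>\<^sub>\<infinity>k\<in>{k \<in> A. \<not> p dvd k}. 1 / real k powr s) =
    (\<Sum>\<^sub>\<infinity>k\<in>A. 1 / real k powr s) * (1 - 1 / real p powr s)"
proof -
  let ?f = "\<lambda>k::nat. 1 / real k powr s"
  have "{k \<in> A. \<not> p dvd k} = A - (*) p ` A"
    by (auto simp: mult_mem_iff dvd_def)
  moreover have "(*) p ` A \<subseteq> A"
    by (auto simp: mult_mem_iff)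
  ultimately have "infsum ?f {k \<in> A. \<not> p dvd k} = infsum ?f A - infsum ?f ((*) p ` A)"
    by (simp add: infsum_Diff summable_on_inverse_powr[OF \<open>s > 1\<close>])
  also have "infsum ?f ((*) p ` A) = infsum (?f \<circ> (*) p) A"
    using \<open>p > 0\<close> by (intro infsum_reindex) (auto intro!: inj_onI)
  also have "\<dots> = (\<Sum>\<^sub>\<infinity>k\<in>A. ?f p * ?f k)"
    by (simp add: o_def powr_mult)
  also have "\<dots> = ?f p * infsum ?f A"
    by (rule infsum_cmult_right')
  finally show ?thesis
    by (simp add: algebra_simps)
qed

section \<open>Integers coprime to a primorial\<close>

lemma prime_nth_prime: "prime (nth_prime i)"
  using enumerate_in_set[OF primes_infinite] by (simp add: nth_prime_def)

lemma nth_prime_less_iff: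
  "1 \<le> i \<Longrightarrow> 1 \<le> j \<Longrightarrow> nth_prime i < nth_prime j \<longleftrightarrow> i < j"
  using primes_infinite by (auto simp: nth_prime_def)

lemma nth_prime_eq_iff:
  "1 \<le> i \<Longrightarrow> 1 \<le> j \<Longrightarrow> nth_prime i = nth_prime j \<longleftrightarrow> i = j"
  by (metis nat_neq_iff nth_prime_less_iff)

lemma prime_eq_nth_primeE:
  assumes "prime p"
  obtains i where "i \<ge> 1" "p = nth_prime i"
proof -
  obtain i where "enumerate {p. prime p} i = p"
    using enumerate_Ex[of "{p::nat. prime p}" p] primes_infinite assms by auto
  then show ?thesis
    by (intro that[of "Suc i"]) (simp_all add: nth_prime_def)
qed

lemma less_nth_prime_Suc_iff:
  assumes "n \<ge> 1" "prime p"
  shows "p < nth_prime (Suc n) \<longleftrightarrow> p \<le> nth_prime n"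
proof -
  obtain i where "i \<ge> 1" "p = nth_prime i"
    using \<open>prime p\<close> by (rule prime_eq_nth_primeE)
  then show ?thesis
    using assms by (auto simp: le_less nth_prime_less_iff nth_prime_eq_iff less_Suc_eq)
qed

lemma nth_prime_Suc_le_four_times:
  assumes "n \<ge> 1"
  shows "nth_prime (Suc n) \<le> 4 * nth_prime n - 3"
proof -
  obtain q where "prime q" "nth_prime n < q" "q \<le> 4 * nth_prime n - 3"
    using ex_prime_between_four_times[OF prime_ge_2_nat[OF prime_nth_prime]] by blast
  then show ?thesis
    using less_nth_prime_Suc_iff[OF assms, of q] by simp
qed

lemma prime_dvd_primorial_iff:
  assumes "prime p"
  shows "p dvd primorial n \<longleftrightarrow> p < nth_prime (Suc n)"
proof -
  obtain i where i: "i \<ge> 1" "p = nth_prime i"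
    using assms by (rule prime_eq_nth_primeE)
  have "p dvd primorial n \<longleftrightarrow> (\<exists>j\<in>{1..n}. p dvd nth_prime j)"
    using assms by (simp add: primorial_def prime_dvd_prod_iff)
  also have "\<dots> \<longleftrightarrow> (\<exists>j\<in>{1..n}. nth_prime i = nth_prime j)"
    using assms i prime_nth_prime primes_dvd_imp_eq by (metis dvd_refl)
  also have "\<dots> \<longleftrightarrow> p < nth_prime (Suc n)"
    using i by (auto simp: nth_prime_eq_iff nth_prime_less_iff)
  finally show ?thesis .
qed

definition primorial_coprimes :: "nat \<Rightarrow> nat set" where
  "primorial_coprimes n = {k. k \<ge> 1 \<and> coprime k (primorial n)}"

lemma D_eq_infsum: "D n s = (\<Sum>\<^sub>\<infinity>k\<in>primorial_coprimes n. 1 / real k powr s)"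
  by (simp add: D_def primorial_coprimes_def coprime_iff_gcd_eq_1)

lemma primorial_coprimes_Suc:
  "primorial_coprimes (Suc n) = {k \<in> primorial_coprimes n. \<not> nth_prime (Suc n) dvd k}"
proof -
  have "coprime k (nth_prime (Suc n)) \<longleftrightarrow> \<not> nth_prime (Suc n) dvd k" for k
    using prime_nth_prime[of "Suc n"]
    by (meson coprime_absorb_right coprime_commute not_prime_unit prime_imp_coprime)
  then show ?thesis
    by (auto simp: primorial_coprimes_def primorial_def)
qed

lemma coprime_nth_prime_Suc_primorial: "coprime (nth_prime (Suc n)) (primorial n)"
  by (intro prime_imp_coprime) (auto simp: prime_nth_prime prime_dvd_primorial_iff)

lemma nth_prime_Suc_le_primorial_coprime:
  assumes "k \<in> primorial_coprimes n" "k \<noteq> 1"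
  shows "nth_prime (Suc n) \<le> k"
proof -
  obtain p where p: "prime p" "p dvd k"
    using prime_factor_nat[OF \<open>k \<noteq> 1\<close>] by blast
  then have "\<not> p dvd primorial n"
    using assms coprime_common_divisor not_prime_unit by (auto simp: primorial_coprimes_def)
  then have "nth_prime (Suc n) \<le> p"
    using p by (simp add: prime_dvd_primorial_iff)
  also have "p \<le> k"
    using p assms by (intro dvd_imp_le) (auto simp: primorial_coprimes_def)
  finally show ?thesis .
qed

lemma odd_primorial_coprime:
  assumes "k \<in> primorial_coprimes n" "n \<ge> 1"
  shows "odd k"
proof -
  have "nth_prime 1 < nth_prime (Suc n)"
    using assms by (simp add: nth_prime_less_iff)
  then have "2 dvd primorial n"
    using prime_ge_2_nat[OF prime_nth_prime[of 1]] by (subst prime_dvd_primorial_iff) auto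
  then show ?thesis
    using assms coprime_common_divisor[of k "primorial n" 2] by (auto simp: primorial_coprimes_def)
qed

lemma primorial_coprimes_subset_arith_progression:
  assumes "n \<ge> 1"
  shows "primorial_coprimes n - {1} \<subseteq> range (\<lambda>i. nth_prime (Suc n) + 2 * i)"
proof
  fix k assume k: "k \<in> primorial_coprimes n - {1}"
  have "nth_prime (Suc n) \<in> primorial_coprimes n"
    using prime_ge_1_nat[OF prime_nth_prime]
    by (simp add: primorial_coprimes_def coprime_nth_prime_Suc_primorial)
  then have "even (k - nth_prime (Suc n))"
    using k assms by (auto dest: odd_primorial_coprime)
  moreover have "nth_prime (Suc n) \<le> k"
    using k by (auto intro: nth_prime_Suc_le_primorial_coprime)
  ultimately show "k \<in> range (\<lambda>i. nth_prime (Suc n) + 2 * i)"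
    by (auto elim!: evenE intro!: image_eqI[of _ _ "(k - nth_prime (Suc n)) div 2"])
qed

section \<open>Recovering the next prime\<close>

lemma D_0: "D 0 s = zeta s"
  by (simp add: D_eq_infsum zeta_def primorial_coprimes_def primorial_def atLeast_def)

lemma D_Suc:
  assumes "s > 1"
  shows "D (Suc n) s = D n s * (1 - 1 / real (nth_prime (Suc n)) powr s)"
  unfolding D_eq_infsum primorial_coprimes_Suc
proof (rule infsum_inverse_powr_not_dvd[OF assms])
  show "nth_prime (Suc n) > 0"
    by (rule prime_gt_0_nat[OF prime_nth_prime])
  then show "nth_prime (Suc n) * k \<in> primorial_coprimes n \<longleftrightarrow> k \<in> primorial_coprimes n" for k
    by (auto simp: primorial_coprimes_def coprime_nth_prime_Suc_primorial Suc_le_eq)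
qed

lemma D_eq_zeta_prod:
  assumes "s > 1"
  shows "D n s = zeta s * (\<Prod>j=1..n. 1 - 1 / real (nth_prime j) powr s)"
  by (induction n) (simp_all add: D_0 D_Suc assms)

lemma D_minus_1_eq_infsum:
  assumes "s > 1"
  shows "D n s - 1 = (\<Sum>\<^sub>\<infinity>k\<in>primorial_coprimes n - {1}. 1 / real k powr s)"
proof -
  have "(\<Sum>\<^sub>\<infinity>k\<in>primorial_coprimes n - {1}. 1 / real k powr s) =
      D n s - (\<Sum>\<^sub>\<infinity>k\<in>{1::nat}. 1 / real k powr s)"
    unfolding D_eq_infsum
    by (intro infsum_Diff summable_on_inverse_powr assms) (simp add: primorial_coprimes_def)
  then show ?thesis
    by simp
qed

lemma D_minus_1_ge:
  assumes "s > 1"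
  shows "real (nth_prime (Suc n)) powr (- s) \<le> D n s - 1"
proof -
  have "(\<Sum>k\<in>{nth_prime (Suc n)}. 1 / real k powr s) \<le> D n s - 1"
    unfolding D_minus_1_eq_infsum[OF assms]
    using prime_gt_1_nat[OF prime_nth_prime[of "Suc n"]]
    by (intro finite_sum_le_infsum summable_on_inverse_powr assms)
      (auto simp: primorial_coprimes_def coprime_nth_prime_Suc_primorial)
  then show ?thesis
    by (simp add: powr_minus_divide)
qed

lemma D_minus_1_less:
  assumes "n \<ge> 1" "real (nth_prime (Suc n)) + 1 < 2 * s"
  shows "D n s - 1 < (real (nth_prime (Suc n)) - 1) powr (- s)"
proof -
  define q where "q = nth_prime (Suc n)"
  have "q > 1"
    unfolding q_def by (rule prime_gt_1_nat[OF prime_nth_prime])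
  then have "s > 1"
    using assms by (simp add: q_def)
  have "D n s - 1 \<le> (real q - 1) powr (1 - s) / (2 * (s - 1))"
    unfolding D_minus_1_eq_infsum[OF \<open>s > 1\<close>]
    using infsum_inverse_powr_arith_progression_le[OF \<open>s > 1\<close> _ _
        primorial_coprimes_subset_arith_progression[OF \<open>n \<ge> 1\<close>]] \<open>q > 1\<close>
    by (simp add: q_def)
  also have "\<dots> = (real q - 1) powr (- s) * ((real q - 1) / (2 * (s - 1)))"
    using powr_add[of "real q - 1" "- s" 1] \<open>q > 1\<close> by simp
  also have "\<dots> < (real q - 1) powr (- s) * 1"
    using assms \<open>q > 1\<close> \<open>s > 1\<close> by (intro mult_strict_left_mono) (auto simp: q_def)
  finally show ?thesis
    by (simp add: q_def)
qed

lemma ceiling_powr_inverse_eq: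
  fixes q :: int and s x :: real
  assumes "s > 0" "q > 1" and lower: "real_of_int q powr (- s) \<le> x"
    and upper: "x < (real_of_int q - 1) powr (- s)"
  shows "\<lceil>x powr (- 1 / s)\<rceil> = q"
proof (rule ceiling_unique)
  have "0 < real_of_int q powr (- s)"
    using \<open>q > 1\<close> by simp
  then have "x > 0"
    using lower by linarith
  have root: "(y powr (- s)) powr (- 1 / s) = y" if "y > 0" for y
    using that \<open>s > 0\<close> by (simp add: powr_powr)
  have "((real_of_int q - 1) powr (- s)) powr (- 1 / s) < x powr (- 1 / s)"
    using upper \<open>x > 0\<close> \<open>s > 0\<close> by (intro powr_less_mono2_neg) auto
  then show "real_of_int q - 1 < x powr (- 1 / s)"
    using \<open>q > 1\<close> by (simp only: root)
  have "x powr (- 1 / s) \<le> (real_of_int q powr (- s)) powr (- 1 / s)"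
    using lower \<open>q > 1\<close> \<open>s > 0\<close> by (intro powr_mono2') auto
  then show "x powr (- 1 / s) \<le> real_of_int q"
    using \<open>q > 1\<close> by (simp only: root)
qed

lemma mem_thresholds:
  assumes "n \<ge> 1" "real (nth_prime (Suc n)) + 1 < 2 * \<sigma>"
  shows "\<sigma> \<in> thresholds n"
proof -
  have q: "nth_prime (Suc n) > 1"
    by (rule prime_gt_1_nat[OF prime_nth_prime])
  have "\<lceil>(D n s - 1) powr (- 1 / s)\<rceil> = int (nth_prime (Suc n))" if "s \<ge> \<sigma>" for s
    using D_minus_1_ge[of s n] D_minus_1_less[of n s] assms q that
    by (intro ceiling_powr_inverse_eq) auto
  then show ?thesis
    using assms q by (auto simp: thresholds_def)
qed

lemma s_min_le:
  assumes "\<sigma> \<in> thresholds n"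
  shows "s_min n \<le> \<sigma>"
  unfolding s_min_def
proof (rule cInf_lower[OF assms])
  show "bdd_below (thresholds n)"
    by (rule bdd_belowI[of _ 0]) (simp add: thresholds_def)
qed

theorem mainTheorem3:
  fixes n :: nat
  assumes "n \<ge> 1"
  shows "(\<forall>s>1. D n s = zeta s * (\<Prod>j=1..n. 1 - 1 / real (nth_prime j) powr s))
    \<and> thresholds n \<noteq> {} \<and> s_min n \<le> 2 * real (nth_prime n)
    \<and> int (nth_prime (n + 1)) =
        \<lceil>(- 1 + zeta (2 * real (nth_prime n)) *
            (\<Prod>j=1..n. 1 - 1 / real (nth_prime j) powr (2 * real (nth_prime n))))
          powr (- 1 / (2 * real (nth_prime n)))\<rceil>"
proof -
  define \<sigma> where "\<sigma> = 2 * real (nth_prime n)"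
  have "real (nth_prime (Suc n)) + 1 < 2 * \<sigma>"
    using nth_prime_Suc_le_four_times[OF assms] prime_ge_2_nat[OF prime_nth_prime[of n]]
    by (simp add: \<sigma>_def)
  with assms have mem: "\<sigma> \<in> thresholds n"
    by (rule mem_thresholds)
  then have "\<sigma> > 1" "int (nth_prime (n + 1)) = \<lceil>(D n \<sigma> - 1) powr (- 1 / \<sigma>)\<rceil>"
    by (auto simp: thresholds_def)
  then have "int (nth_prime (n + 1)) =
      \<lceil>(- 1 + zeta \<sigma> * (\<Prod>j=1..n. 1 - 1 / real (nth_prime j) powr \<sigma>)) powr (- 1 / \<sigma>)\<rceil>"
    by (simp add: D_eq_zeta_prod)
  then show ?thesis
    using D_eq_zeta_prod s_min_le[OF mem] mem unfolding \<sigma>_def by blast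
qed

end
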